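(* A topological Brandt $\lambda^0$-extension $B^0_\lambda(S)$ of a topological monoid $(S,\tau)$ with zero is compact if and only if the cardinal $\lambda\geqslant 1$ is finite and $(S,\tau)$ is a compact topological semigroup. Moreover, for any compact topological monoid $(S,\tau)$ with zero and for any finite cardinal $\lambda\geqslant 1$ there exists a unique compact topological Brandt $\lambda^0$-extension $(B^0_\lambda(S),\tau_B)$ of $(S,\tau)$, and the topology $\tau_B$ is generated by the base $\mathscr{B}_B=\bigcup\{\mathscr{B}_B(t): t\in B^0_\lambda(S)\}$, where: (i) $\mathscr{B}_B(t)=\{(U(s))_{\alpha,\beta}\setminus\{0\}: U(s)\in\mathscr{B}_S(s)\}$, when $t=(\alpha,s,\beta)$ is a non-zero element of $B^0_\lambda(S)$, $\alpha,\beta\in I_\lambda$; (ii) $\mathscr{B}_B(0)=\bigl\{\bigcup_{\alpha,\beta\in I_\lambda}(U(0_S))_{\alpha,\beta}: U(0_S)\in\mathscr{B}_S(0_S)\bigr\}$, when $0$ is the zero of $B^0_\lambda(S)$, and $\mathscr{B}_S(s)$ is a base of the topology $\tau$ at the point $s\in S$.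
   Context: All topological spaces are Hausdorff; a topological semigroup is a semigroup with a topology making multiplication jointly continuous. $I_\lambda$ denotes a set of cardinality $\lambda\geqslant 1$. For a monoid $S$ with zero $0_S$, the Brandt $\lambda^0$-extension $B^0_\lambda(S)$ is the set $\{(\alpha,s,\beta):\alpha,\beta\in I_\lambda,\ s\in S\setminus\{0_S\}\}\cup\{0\}$ with multiplication $(\alpha,a,\beta)(\gamma,b,\delta)=(\alpha,ab,\delta)$ if $\beta=\gamma$ and $ab\neq 0_S$, all other products being equal to $0$. For $A\subseteq S$ put $A_{\alpha,\beta}=\{(\alpha,s,\beta):s\in A\}$ if $0_S\notin A$, and $A_{\alpha,\beta}=\{(\alpha,s,\beta):s\in A\setminus\{0_S\}\}\cup\{0\}$ if $0_S\in A$. If $(S,\tau)$ is a topological monoid with zero, a topological Brandt $\lambda^0$-extension of $(S,\tau)$ is $(B^0_\lambda(S),\tau_B)$ where $\tau_B$ is a topology making $B^0_\lambda(S)$ a topological semigroup and such that for some $\alpha\in I_\lambda$ the subspace topology on $S_{\alpha,\alpha}$ coincides with $\tau$ under the identification $s\mapsto(\alpha,s,\alpha)$, $0_S\mapsto 0$. It is called compact if the space $(B^0_\lambda(S),\tau_B)$ is compact.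
   Formalization: The compactness equivalence is stated for S ≠ {0_S}: if S = {0_S}, then B^0_λ(S) = {0} is compact for every λ, also infinite, so the "only if" fails; the existence, uniqueness and base claims are proved without this restriction. *)

theory Defs
  imports "HOL-Analysis.Analysis" "HOL-Algebra.Group"
begin

definition topological_semigroup_on :: "'a set \<Rightarrow> ('a \<Rightarrow> 'a \<Rightarrow> 'a) \<Rightarrow> 'a topology \<Rightarrow> bool" where
  "topological_semigroup_on A f X \<longleftrightarrow>
     topspace X = A \<and> Hausdorff_space X \<and>
     (\<forall>x\<in>A. \<forall>y\<in>A. f x y \<in> A) \<and>
     (\<forall>x\<in>A. \<forall>y\<in>A. \<forall>w\<in>A. f (f x y) w = f x (f y w)) \<and>
     continuous_map (prod_topology X X) X (\<lambda>(x, y). f x y)"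

text \<open>The degenerate case, in which the zero is also the identity, is not excluded here.\<close>

definition topological_monoid_with_zero ::
    "('s, 'm) monoid_scheme \<Rightarrow> 's \<Rightarrow> 's topology \<Rightarrow> bool" where
  "topological_monoid_with_zero S z X \<longleftrightarrow>
     Group.monoid S \<and>
     z \<in> carrier S \<and> (\<forall>s\<in>carrier S. z \<otimes>\<^bsub>S\<^esub> s = z \<and> s \<otimes>\<^bsub>S\<^esub> z = z) \<and>
     topological_semigroup_on (carrier S) (mult S) X"

datatype ('i, 's) brandt = Zero | Triple 'i 's 'i

text \<open>
  The set \<open>I\<close> plays the role of the index set of cardinality \<open>\<lambda>\<close>, and \<open>z\<close> is the zero of \<open>S\<close>.
  The datatype also contains triples with middle entry \<open>z\<close>; the carrier leaves them out.
\<close>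

definition brandt_carrier ::
    "('s, 'm) monoid_scheme \<Rightarrow> 's \<Rightarrow> 'i set \<Rightarrow> ('i, 's) brandt set" where
  "brandt_carrier S z I =
     {Triple \<alpha> s \<beta> | \<alpha> s \<beta>. \<alpha> \<in> I \<and> \<beta> \<in> I \<and> s \<in> carrier S - {z}} \<union> {Zero}"

fun brandt_mult ::
    "('s, 'm) monoid_scheme \<Rightarrow> 's \<Rightarrow> ('i, 's) brandt \<Rightarrow> ('i, 's) brandt \<Rightarrow> ('i, 's) brandt" where
  "brandt_mult S z (Triple \<alpha> a \<beta>) (Triple \<gamma> b \<delta>) =
     (if \<beta> = \<gamma> \<and> a \<otimes>\<^bsub>S\<^esub> b \<noteq> z then Triple \<alpha> (a \<otimes>\<^bsub>S\<^esub> b) \<delta> else Zero)"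
| "brandt_mult S z Zero _ = Zero"
| "brandt_mult S z _ Zero = Zero"

text \<open>The set \<open>A\<^sub>\<alpha>\<^sub>,\<^sub>\<beta>\<close> for a subset \<open>A\<close> of \<open>S\<close>.\<close>

definition brandt_block :: "'s \<Rightarrow> 's set \<Rightarrow> 'i \<Rightarrow> 'i \<Rightarrow> ('i, 's) brandt set" where
  "brandt_block z A \<alpha> \<beta> =
     (if z \<in> A then {Triple \<alpha> s \<beta> | s. s \<in> A - {z}} \<union> {Zero}
      else {Triple \<alpha> s \<beta> | s. s \<in> A})"

definition brandt_embed :: "'s \<Rightarrow> 'i \<Rightarrow> 's \<Rightarrow> ('i, 's) brandt" where
  "brandt_embed z \<alpha> s = (if s = z then Zero else Triple \<alpha> s \<alpha>)"

definition topological_brandt_extension ::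
    "('s, 'm) monoid_scheme \<Rightarrow> 's \<Rightarrow> 's topology \<Rightarrow> 'i set \<Rightarrow> ('i, 's) brandt topology \<Rightarrow> bool" where
  "topological_brandt_extension S z X I Y \<longleftrightarrow>
     topological_semigroup_on (brandt_carrier S z I) (brandt_mult S z) Y \<and>
     (\<exists>\<alpha>\<in>I. homeomorphic_map X (subtopology Y (brandt_block z (carrier S) \<alpha> \<alpha>))
              (brandt_embed z \<alpha>))"

text \<open>Members of a base at a point are taken to be open.\<close>

definition base_at :: "'a topology \<Rightarrow> 'a \<Rightarrow> 'a set set \<Rightarrow> bool" where
  "base_at X x \<B> \<longleftrightarrow>
     (\<forall>U\<in>\<B>. openin X U \<and> x \<in> U) \<and>
     (\<forall>V. openin X V \<and> x \<in> V \<longrightarrow> (\<exists>U\<in>\<B>. U \<subseteq> V))"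

fun brandt_base_at ::
    "'s \<Rightarrow> 'i set \<Rightarrow> ('s \<Rightarrow> 's set set) \<Rightarrow> ('i, 's) brandt \<Rightarrow> ('i, 's) brandt set set" where
  "brandt_base_at z I \<B> (Triple \<alpha> s \<beta>) = {brandt_block z U \<alpha> \<beta> - {Zero} | U. U \<in> \<B> s}"
| "brandt_base_at z I \<B> Zero = {(\<Union>\<alpha>\<in>I. \<Union>\<beta>\<in>I. brandt_block z U \<alpha> \<beta>) | U. U \<in> \<B> z}"

definition brandt_base ::
    "('s, 'm) monoid_scheme \<Rightarrow> 's \<Rightarrow> 'i set \<Rightarrow> ('s \<Rightarrow> 's set set) \<Rightarrow> ('i, 's) brandt set set" where
  "brandt_base S z I \<B> = (\<Union>t\<in>brandt_carrier S z I. brandt_base_at z I \<B> t)"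

end

theory Submission
  imports Defs
begin

text \<open>
  Write \<open>\<iota>\<^sub>\<alpha>\<^sub>,\<^sub>\<beta> : S \<rightarrow> B\<close> for the map \<open>s \<mapsto> (\<alpha>, s, \<beta>)\<close>, \<open>0\<^sub>S \<mapsto> 0\<close>. Multiplying on both sides by
  matrix units turns one of these maps into any other, so all of them are continuous in every
  topological Brandt extension. If \<open>I\<close> is finite and \<open>S\<close> is compact, then \<open>B\<close> is the finite union of
  the compact images of these maps, hence compact; being Hausdorff, it carries the final
  topology with respect to them, which gives uniqueness and the base. Conversely, that final topology
  is Hausdorff (the coordinate maps \<open>B \<rightarrow> S\<close> separate points) and its multiplication is continuous,
  because \<open>B \<times> B\<close> is a finite union of compact images of \<open>S \<times> S\<close>.

  If \<open>B\<close> is compact and \<open>I\<close> is infinite, let \<open>(x, y)\<close> be an accumulation point of the pairs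
  \<open>((\<alpha>, 1, \<beta>), (\<beta>, 1, \<alpha>))\<close>, \<open>\<beta> \<in> I\<close>. Then \<open>x y = (\<alpha>, 1, \<alpha>)\<close> by continuity, whereas
  \<open>(\<alpha>, 1, \<beta>) (\<gamma>, 1, \<alpha>) = 0\<close> for \<open>\<beta> \<noteq> \<gamma>\<close> forces \<open>x y = 0\<close>.
\<close>

section \<open>Entry maps into the extension and coordinate maps out of it\<close>

text \<open>Unlike the constructor \<open>Triple\<close>, this map sends \<open>z\<close> to
  \<open>Zero\<close>, so it is a map on all of S and no statement about it has to set the zero
  apart.\<close>

definition brandt_elem :: "'s \<Rightarrow> 'i \<Rightarrow> 'i \<Rightarrow> 's \<Rightarrow> ('i, 's) brandt" where
  "brandt_elem z \<alpha> \<beta> s = (if s = z then Zero else Triple \<alpha> s \<beta>)"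

text \<open>An element is viewed as a matrix with at most one entry other than \<open>z\<close>, and
  one position is read off. The default \<open>z\<close> agrees with the value at
  \<open>Zero\<close>.\<close>

fun brandt_coord :: "'s \<Rightarrow> 'i \<Rightarrow> 'i \<Rightarrow> ('i, 's) brandt \<Rightarrow> 's" where
  "brandt_coord z \<alpha> \<beta> Zero = z"
| "brandt_coord z \<alpha> \<beta> (Triple \<gamma> s \<delta>) = (if \<alpha> = \<gamma> \<and> \<beta> = \<delta> then s else z)"

lemma brandt_coord_elem:
  "brandt_coord z \<alpha> \<beta> (brandt_elem z \<gamma> \<delta> s) = (if \<alpha> = \<gamma> \<and> \<beta> = \<delta> then s else z)"
  by (simp add: brandt_elem_def)

lemma brandt_elem_zero [simp]: "brandt_elem z \<alpha> \<beta> z = Zero"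
  by (simp add: brandt_elem_def)

lemma brandt_embed_eq_elem: "brandt_embed z \<alpha> = brandt_elem z \<alpha> \<alpha>"
  by (auto simp: brandt_embed_def brandt_elem_def)

lemma brandt_block_eq_image: "brandt_block z A \<alpha> \<beta> = brandt_elem z \<alpha> \<beta> ` A"
  by (auto simp: brandt_block_def brandt_elem_def image_iff)

lemma brandt_mult_Zero [simp]:
  "brandt_mult S z Zero x = Zero" "brandt_mult S z x Zero = Zero"
  by (cases x; simp)+

text \<open>Disjoint neighbourhoods of \<open>f x\<close> and \<open>f y\<close> pull back to
  disjoint neighbourhoods of x and y. The map may depend on the pair.\<close>

lemma Hausdorff_space_separating_maps:
  assumes "\<And>x y. \<lbrakk>x \<in> topspace X; y \<in> topspace X; x \<noteq> y\<rbrakk>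
            \<Longrightarrow> \<exists>Y f. Hausdorff_space Y \<and> continuous_map X (Y :: 'b topology) f \<and> f x \<noteq> f y"
  shows "Hausdorff_space X"
  unfolding Hausdorff_space_def
proof clarify
  fix x y assume xy: "x \<in> topspace X" "y \<in> topspace X" "x \<noteq> y"
  then obtain Y :: "'b topology" and f
    where Y: "Hausdorff_space Y" and f: "continuous_map X Y f" "f x \<noteq> f y"
    using assms by blast
  have "f x \<in> topspace Y" "f y \<in> topspace Y"
    using f(1) xy by (auto simp: continuous_map)
  then obtain U V where UV: "openin Y U" "openin Y V" "f x \<in> U" "f y \<in> V" "disjnt U V"
    using Y f(2) unfolding Hausdorff_space_def by blast
  show "\<exists>U V. openin X U \<and> openin X V \<and> x \<in> U \<and> y \<in> V \<and> disjnt U V"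
  proof (intro exI conjI)
    show "openin X {u \<in> topspace X. f u \<in> U}" "openin X {u \<in> topspace X. f u \<in> V}"
      using f(1) UV by (auto intro: openin_continuous_map_preimage)
  qed (use xy UV in \<open>auto simp: disjnt_iff\<close>)
qed

lemma continuous_map_mult:
  assumes "topological_semigroup_on A m X" "continuous_map Y X f" "continuous_map Y X g"
  shows "continuous_map Y X (\<lambda>x. m (f x) (g x))"
proof -
  have "continuous_map Y (prod_topology X X) (\<lambda>x. (f x, g x))"
    using assms by (simp add: continuous_map_pairedI)
  moreover have "continuous_map (prod_topology X X) X (\<lambda>(x, y). m x y)"
    using assms by (simp add: topological_semigroup_on_def)
  ultimately show ?thesis
    using continuous_map_compose by (fastforce simp: o_def)
qed

section \<open>Algebra of the Brandt extension in terms of entries\<close>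

locale brandt_setting =
  fixes S :: "('s, 'm) monoid_scheme" (structure)
    and z :: 's and \<tau> :: "'s topology" and I :: "'i set"
  assumes S: "topological_monoid_with_zero S z \<tau>" and I: "I \<noteq> {}"
begin

abbreviation "B \<equiv> brandt_carrier S z I"
abbreviation "entry \<equiv> brandt_elem z"
abbreviation "coord \<equiv> brandt_coord z"
abbreviation bmult (infixl "\<diamondop>" 70) where "x \<diamondop> y \<equiv> brandt_mult S z x y"
abbreviation "extension \<equiv> topological_brandt_extension S z \<tau> I"

sublocale monoid S
  using S by (simp add: topological_monoid_with_zero_def)

lemma zero_closed [simp]: "z \<in> carrier S"
  and zero_mult [simp]: "s \<in> carrier S \<Longrightarrow> z \<otimes> s = z" "s \<in> carrier S \<Longrightarrow> s \<otimes> z = z"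
  and semigroup: "topological_semigroup_on (carrier S) (\<otimes>) \<tau>"
  using S by (auto simp: topological_monoid_with_zero_def)

lemma topspace_tau [simp]: "topspace \<tau> = carrier S"
  and Hausdorff_tau: "Hausdorff_space \<tau>"
  using semigroup by (auto simp: topological_semigroup_on_def)

lemma elem_closed [simp]: "\<lbrakk>\<alpha> \<in> I; \<beta> \<in> I; s \<in> carrier S\<rbrakk> \<Longrightarrow> entry \<alpha> \<beta> s \<in> B"
  by (auto simp: brandt_elem_def brandt_carrier_def)

lemma Zero_closed [simp]: "Zero \<in> B"
  by (auto simp: brandt_carrier_def)

text \<open>A single case covers the whole carrier: \<open>Zero\<close> is the entry
  \<open>z\<close> in any block, and a block exists because \<open>I\<close> is nonempty.\<close>

lemma carrier_cases:
  assumes "x \<in> B"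
  obtains \<alpha> \<beta> s where "\<alpha> \<in> I" "\<beta> \<in> I" "s \<in> carrier S" "x = entry \<alpha> \<beta> s"
proof (cases x)
  case Zero
  with I that[of _ _ z] show ?thesis by auto
next
  case (Triple \<alpha> s \<beta>)
  with assms that[of \<alpha> \<beta> s] show ?thesis
    by (auto simp: brandt_carrier_def brandt_elem_def)
qed

lemma carrier_eq_UN: "B = (\<Union>(\<alpha>, \<beta>)\<in>I \<times> I. entry \<alpha> \<beta> ` carrier S)"
  by (auto; metis carrier_cases image_eqI)

text \<open>This is the rule for matrix units. It survives when a factor or the product is
  \<open>z\<close>, because both sides are then \<open>Zero\<close>.\<close>

lemma mult_elem [simp]:
  assumes "s \<in> carrier S" "t \<in> carrier S"
  shows "entry \<alpha> \<beta> s \<diamondop> entry \<gamma> \<delta> t = (if \<beta> = \<gamma> then entry \<alpha> \<delta> (s \<otimes> t) else Zero)"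
  using assms by (auto simp: brandt_elem_def)

lemma mult_closed: "\<lbrakk>x \<in> B; y \<in> B\<rbrakk> \<Longrightarrow> x \<diamondop> y \<in> B"
  by (elim carrier_cases) auto

lemma mult_assoc: "\<lbrakk>x \<in> B; y \<in> B; w \<in> B\<rbrakk> \<Longrightarrow> (x \<diamondop> y) \<diamondop> w = x \<diamondop> (y \<diamondop> w)"
  by (elim carrier_cases) (auto simp: m_assoc)

section \<open>Arbitrary topological Brandt extensions\<close>

context
  fixes Y :: "('i, 's) brandt topology"
  assumes Y: "extension Y"
begin

lemma extension_semigroup: "topological_semigroup_on B (\<diamondop>) Y"
  using Y by (simp add: topological_brandt_extension_def)

lemma topspace_extension: "topspace Y = B"
  and Hausdorff_extension: "Hausdorff_space Y"
  using extension_semigroup by (auto simp: topological_semigroup_on_def)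

lemma continuous_map_translate:
  assumes "a \<in> B" "b \<in> B" "continuous_map X Y f"
  shows "continuous_map X Y (\<lambda>x. a \<diamondop> f x \<diamondop> b)"
  using assms topspace_extension
  by (intro continuous_map_mult[OF extension_semigroup]) auto

text \<open>The definition controls one diagonal block \<gamma> only. The matrix units
  \<open>entry \<alpha> \<gamma> \<one>\<close> on the left and
  \<open>entry \<gamma> \<beta> \<one>\<close> on the right carry that block to any other, and
  translations are continuous.\<close>

lemma continuous_map_elem:
  assumes "\<alpha> \<in> I" "\<beta> \<in> I"
  shows "continuous_map \<tau> Y (entry \<alpha> \<beta>)"
proof -
  obtain \<gamma> where \<gamma>: "\<gamma> \<in> I"
    and hom: "homeomorphic_map \<tau> (subtopology Y (brandt_block z (carrier S) \<gamma> \<gamma>)) (entry \<gamma> \<gamma>)"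
    using Y by (auto simp: topological_brandt_extension_def brandt_embed_eq_elem)
  have "continuous_map \<tau> Y (entry \<gamma> \<gamma>)"
    using homeomorphic_imp_continuous_map[OF hom] by (simp add: continuous_map_in_subtopology)
  then have "continuous_map \<tau> Y (\<lambda>s. entry \<alpha> \<gamma> \<one> \<diamondop> entry \<gamma> \<gamma> s \<diamondop> entry \<gamma> \<beta> \<one>)"
    using assms \<gamma> by (intro continuous_map_translate) auto
  then show ?thesis
    by (rule continuous_map_eq) auto
qed

lemma compact_extension:
  assumes "finite I" "compact_space \<tau>"
  shows "compact_space Y"
proof -
  have "compactin Y B"
    unfolding carrier_eq_UN
    using assms by (intro compactin_Union)
      (auto intro!: image_compactin continuous_map_elem simp: compact_space_def)
  then show ?thesis
    by (simp add: compact_space_def topspace_extension)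
qed

text \<open>The diagonal block homeomorphic to S is the corner \<open>e B e\<close> of an idempotent
  e. It is therefore a continuous image of the compact space B.\<close>

lemma compact_of_compact_extension:
  assumes "compact_space Y"
  shows "compact_space \<tau>"
proof -
  obtain \<alpha> where \<alpha>: "\<alpha> \<in> I"
    and hom: "homeomorphic_map \<tau> (subtopology Y (brandt_block z (carrier S) \<alpha> \<alpha>)) (entry \<alpha> \<alpha>)"
    using Y by (auto simp: topological_brandt_extension_def brandt_embed_eq_elem)
  define e where "e = entry \<alpha> \<alpha> \<one>"
  have e: "e \<in> B"
    using \<alpha> by (simp add: e_def)
  have corner: "(\<lambda>x. e \<diamondop> x \<diamondop> e) ` B = entry \<alpha> \<alpha> ` carrier S"
  proof
    show "(\<lambda>x. e \<diamondop> x \<diamondop> e) ` B \<subseteq> entry \<alpha> \<alpha> ` carrier S"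
    proof clarify
      fix x assume "x \<in> B"
      \<comment> \<open>Outside the corner the product is \<open>Zero\<close>, which is the entry of
        \<open>z\<close>.\<close>
      then show "e \<diamondop> x \<diamondop> e \<in> entry \<alpha> \<alpha> ` carrier S"
        by (elim carrier_cases) (auto simp: e_def image_iff intro: bexI[of _ z])
    qed
    show "entry \<alpha> \<alpha> ` carrier S \<subseteq> (\<lambda>x. e \<diamondop> x \<diamondop> e) ` B"
    proof (intro image_subsetI)
      fix s assume "s \<in> carrier S"
      \<comment> \<open>Since e is a two-sided identity on the corner, each corner element is its
        own preimage.\<close>
      then have "entry \<alpha> \<alpha> s = e \<diamondop> entry \<alpha> \<alpha> s \<diamondop> e" "entry \<alpha> \<alpha> s \<in> B"
        using \<alpha> by (simp_all add: e_def)
      then show "entry \<alpha> \<alpha> s \<in> (\<lambda>x. e \<diamondop> x \<diamondop> e) ` B"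
        by (rule image_eqI)
    qed
  qed
  have "compactin Y ((\<lambda>x. e \<diamondop> x \<diamondop> e) ` B)"
    using assms e topspace_extension
    by (intro image_compactin[of Y] continuous_map_translate) (auto simp: compact_space_def)
  then have "compact_space (subtopology Y (brandt_block z (carrier S) \<alpha> \<alpha>))"
    by (simp add: corner brandt_block_eq_image compact_space_subtopology)
  then show ?thesis
    using hom homeomorphic_compact_space homeomorphic_map_imp_homeomorphic_space by blast
qed

text \<open>For trivial S the extension is a single point whatever \<open>I\<close> is. Excluding
  this case gives \<open>\<one> \<noteq> z\<close>, which keeps the pairs \<open>p \<beta>\<close>
  distinct and tells matrix units from \<open>Zero\<close>.\<close>

lemma finite_index_of_compact_extension:
  assumes "compact_space Y" "carrier S \<noteq> {z}"
  shows "finite I"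
proof (rule ccontr)
  assume inf: "infinite I"
  obtain \<alpha> where \<alpha>: "\<alpha> \<in> I" using I by blast
  have "\<one> \<noteq> z"
    using assms(2) by (metis l_one subset_singletonD subsetI singletonI empty_iff
      zero_closed zero_mult(1))
  define p where "p \<beta> = (entry \<alpha> \<beta> \<one>, entry \<beta> \<alpha> \<one>)" for \<beta>
  let ?P = "prod_topology Y Y"
  have mult: "continuous_map ?P Y (\<lambda>(x, y). x \<diamondop> y)"
    using extension_semigroup by (simp add: topological_semigroup_on_def)
  have "inj_on p I"
    using \<open>\<one> \<noteq> z\<close> by (auto simp: inj_on_def p_def brandt_elem_def)
  then have "infinite (p ` I)"
    using inf by (simp add: finite_image_iff)
  moreover have "p ` I \<subseteq> topspace ?P"
    using \<alpha> by (auto simp: p_def topspace_extension)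
  moreover have "compact_space ?P"
    using assms(1) by (simp add: compact_space_prod_topology)
  ultimately obtain x y where xy: "(x, y) \<in> ?P derived_set_of (p ` I)"
    using compact_space_imp_Bolzano_Weierstrass by (metis equals0I surj_pair)
  have "Hausdorff_space ?P"
    using Hausdorff_extension by (simp add: Hausdorff_space_prod_topology)
  \<comment> \<open>In a Hausdorff space every neighbourhood of an accumulation point contains
    infinitely many members of the set. One member would not suffice: two different indices are
    needed below.\<close>
  then have acc: "infinite (p ` I \<inter> W)" if "openin ?P W" "(x, y) \<in> W" for W
    using xy that by (simp add: derived_set_of_infinite_openin)
  have xyB: "x \<in> B" "y \<in> B"
    using xy by (auto simp: in_derived_set_of topspace_extension)
  \<comment> \<open>All pairs \<open>p \<beta>\<close> have the product
    \<open>entry \<alpha> \<alpha> \<one>\<close>, so the open set of pairs with another product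
    misses them and cannot contain (x, y).\<close>
  have "x \<diamondop> y = entry \<alpha> \<alpha> \<one>"
  proof (rule ccontr)
    assume ne: "x \<diamondop> y \<noteq> entry \<alpha> \<alpha> \<one>"
    have "openin Y (topspace Y - {entry \<alpha> \<alpha> \<one>})"
      using Hausdorff_extension \<alpha>
      by (intro openin_diff openin_topspace closedin_Hausdorff_singleton) (auto simp: topspace_extension)
    then have "openin ?P {q \<in> topspace ?P. (\<lambda>(x, y). x \<diamondop> y) q \<in> topspace Y - {entry \<alpha> \<alpha> \<one>}}"
      by (rule openin_continuous_map_preimage[OF mult])
    from acc[OF this] xyB ne have
      "infinite (p ` I \<inter> {q \<in> topspace ?P. (\<lambda>(x, y). x \<diamondop> y) q \<in> topspace Y - {entry \<alpha> \<alpha> \<one>}})"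
      by (auto simp: topspace_extension mult_closed)
    moreover have
      "p ` I \<inter> {q \<in> topspace ?P. (\<lambda>(x, y). x \<diamondop> y) q \<in> topspace Y - {entry \<alpha> \<alpha> \<one>}} = {}"
      by (auto simp: p_def)
    ultimately show False by simp
  qed
  then have "x \<diamondop> y \<noteq> Zero"
    using \<open>\<one> \<noteq> z\<close> by (simp add: brandt_elem_def)
  define W where "W = {q \<in> topspace ?P. (\<lambda>(x, y). x \<diamondop> y) q \<in> topspace Y - {Zero}}"
  have "openin Y (topspace Y - {Zero})"
    using Hausdorff_extension
    by (intro openin_diff openin_topspace closedin_Hausdorff_singleton) (auto simp: topspace_extension)
  then have "openin ?P W"
    unfolding W_def by (rule openin_continuous_map_preimage[OF mult])
  moreover have "(x, y) \<in> W"
    using xyB \<open>x \<diamondop> y \<noteq> Zero\<close> by (auto simp: W_def topspace_extension mult_closed)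
  \<comment> \<open>A box inside \<open>W\<close> allows the first component of one pair to be
    combined with the second component of another.\<close>
  ultimately have "\<exists>U V. openin Y U \<and> openin Y V \<and> x \<in> U \<and> y \<in> V \<and> U \<times> V \<subseteq> W"
    by (simp add: openin_prod_topology_alt)
  then obtain U V where UV: "openin Y U" "openin Y V" "x \<in> U" "y \<in> V" "U \<times> V \<subseteq> W"
    by blast
  then have inf: "infinite (p ` I \<inter> U \<times> V)"
    by (intro acc) (auto simp: openin_prod_Times_iff)
  have hit: "\<exists>\<beta>. p \<beta> \<in> N" if "infinite (p ` I \<inter> N)" for N
    using infinite_imp_nonempty[OF that] by auto
  obtain \<beta> where \<beta>: "p \<beta> \<in> U \<times> V"
    using hit[OF inf] by (elim exE)
  \<comment> \<open>Infinitely many pairs remain after \<open>p \<beta>\<close> is removed, so the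
    box holds a second one with a different index.\<close>
  have "infinite (p ` I \<inter> (U \<times> V - {p \<beta>}))"
    using infinite_remove[OF inf, of "p \<beta>"] unfolding Int_Diff .
  from hit[OF this] obtain \<gamma> where "p \<gamma> \<in> U \<times> V - {p \<beta>}"
    by (elim exE)
  then have \<gamma>: "p \<gamma> \<in> U \<times> V" "p \<gamma> \<noteq> p \<beta>"
    by (simp_all only: Diff_iff) simp
  then have "\<beta> \<noteq> \<gamma>"
    by auto
  \<comment> \<open>The mixed pair stays in the box, hence in \<open>W\<close>, yet its inner
    indices differ and its product is \<open>Zero\<close>.\<close>
  with \<beta> \<gamma>(1) have "(entry \<alpha> \<beta> \<one>, entry \<gamma> \<alpha> \<one>) \<in> W" "entry \<alpha> \<beta> \<one> \<diamondop> entry \<gamma> \<alpha> \<one> = Zero"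
    using UV(5) by (auto simp: p_def)
  then show False
    by (simp add: W_def)
qed

text \<open>A set whose preimages are closed is a finite union of compact images, hence closed.\<close>

lemma openin_extension_iff:
  assumes "finite I" "compact_space \<tau>"
  shows "openin Y U \<longleftrightarrow>
    U \<subseteq> B \<and> (\<forall>\<alpha>\<in>I. \<forall>\<beta>\<in>I. openin \<tau> {s \<in> carrier S. entry \<alpha> \<beta> s \<in> U})"
    (is "_ \<longleftrightarrow> _ \<and> ?pre")
proof (intro iffI conjI ballI)
  assume U: "openin Y U"
  then show "U \<subseteq> B"
    using openin_subset topspace_extension by blast
  fix \<alpha> \<beta> assume "\<alpha> \<in> I" "\<beta> \<in> I"
  then show "openin \<tau> {s \<in> carrier S. entry \<alpha> \<beta> s \<in> U}"
    using openin_continuous_map_preimage[OF continuous_map_elem U] by simp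
next
  assume U: "U \<subseteq> B \<and> ?pre"
  define C where "C \<alpha> \<beta> = {s \<in> carrier S. entry \<alpha> \<beta> s \<notin> U}" for \<alpha> \<beta>
  have "closedin Y (entry \<alpha> \<beta> ` C \<alpha> \<beta>)" if "\<alpha> \<in> I" "\<beta> \<in> I" for \<alpha> \<beta>
  proof -
    have "closedin \<tau> (topspace \<tau> - {s \<in> carrier S. entry \<alpha> \<beta> s \<in> U})"
      using U that by (intro closedin_diff closedin_topspace) auto
    also have "topspace \<tau> - {s \<in> carrier S. entry \<alpha> \<beta> s \<in> U} = C \<alpha> \<beta>"
      by (auto simp: C_def)
    finally have "compactin \<tau> (C \<alpha> \<beta>)"
      using assms(2) closedin_compact_space by blast
    then show ?thesis
      using that by (intro compactin_imp_closedin Hausdorff_extension image_compactin[of \<tau>]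
          continuous_map_elem)
  qed
  then have "closedin Y (\<Union>((\<lambda>(\<alpha>, \<beta>). entry \<alpha> \<beta> ` C \<alpha> \<beta>) ` (I \<times> I)))"
    using assms(1) by (intro closedin_Union) auto
  moreover have "(\<Union>((\<lambda>(\<alpha>, \<beta>). entry \<alpha> \<beta> ` C \<alpha> \<beta>) ` (I \<times> I))) = B - U"
    by (auto simp: C_def elim!: carrier_cases)
  ultimately have "openin Y (topspace Y - (B - U))"
    by (auto simp: closedin_def)
  then show "openin Y U"
    using U by (simp add: topspace_extension double_diff)
qed

section \<open>The base of the topology\<close>

text \<open>Both halves of the base criterion are checked block by block: a set is open as soon as
  its preimages under the entry maps are.\<close>

lemma openin_extension_base:
  assumes fin: "finite I" "compact_space \<tau>"
    and base: "\<And>s. s \<in> carrier S \<Longrightarrow> base_at \<tau> s (\<B> s)"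
  shows "openin Y = arbitrary union_of (\<lambda>W. W \<in> brandt_base S z I \<B>)"
  unfolding openin_topology_base_unique
proof (intro conjI allI impI)
  fix W assume "W \<in> brandt_base S z I \<B>"
  then obtain t where t: "t \<in> B" "W \<in> brandt_base_at z I \<B> t"
    by (auto simp: brandt_base_def)
  show "openin Y W"
  proof (cases t)
    case Zero
    then obtain U where U: "U \<in> \<B> z" and W: "W = (\<Union>\<alpha>\<in>I. \<Union>\<beta>\<in>I. entry \<alpha> \<beta> ` U)"
      using t by (auto simp: brandt_block_eq_image)
    have U': "openin \<tau> U" "z \<in> U"
      using base[of z] U by (auto simp: base_at_def)
    then have "U \<subseteq> carrier S"
      using openin_subset by fastforce
    \<comment> \<open>\<open>Zero\<close> lies in \<open>W\<close> and \<open>z\<close> lies in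
      \<open>U\<close>, so the two sides agree at \<open>z\<close> as well.\<close>
    then have "{s \<in> carrier S. entry \<alpha> \<beta> s \<in> W} = U" if "\<alpha> \<in> I" "\<beta> \<in> I" for \<alpha> \<beta>
      using that U' by (auto simp: W brandt_elem_def split: if_splits)
    moreover have "W \<subseteq> B"
      using \<open>U \<subseteq> carrier S\<close> by (auto simp: W)
    ultimately show ?thesis
      using U' by (simp add: openin_extension_iff[OF fin])
  next
    case (Triple \<alpha> s \<beta>)
    then have s: "\<alpha> \<in> I" "\<beta> \<in> I" "s \<in> carrier S"
      using t by (auto simp: brandt_carrier_def)
    obtain U where U: "U \<in> \<B> s" and W: "W = entry \<alpha> \<beta> ` U - {Zero}"
      using t Triple by (auto simp: brandt_block_eq_image)
    have U': "openin \<tau> U"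
      using base[of s] s U by (auto simp: base_at_def)
    then have sub: "U \<subseteq> carrier S"
      using openin_subset by fastforce
    \<comment> \<open>Deleting \<open>Zero\<close> from the base set deletes \<open>z\<close> from
      its preimage, which stays open because points are closed in a Hausdorff space. The deletion
      also leaves nothing in the other blocks.\<close>
    have "openin \<tau> (U - {z})"
      using U' Hausdorff_tau by (intro openin_diff closedin_Hausdorff_singleton) auto
    moreover have "{s \<in> carrier S. entry \<gamma> \<delta> s \<in> W} = (if \<gamma> = \<alpha> \<and> \<delta> = \<beta> then U - {z} else {})"
      for \<gamma> \<delta>
      using sub by (auto simp: W brandt_elem_def split: if_splits)
    moreover have "W \<subseteq> B"
      using sub s by (auto simp: W)
    ultimately show ?thesis
      by (simp add: openin_extension_iff[OF fin])
  qed
next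
  fix W t assume "openin Y W \<and> t \<in> W"
  then have W: "W \<subseteq> B" "t \<in> W"
    and pre: "\<And>\<alpha> \<beta>. \<lbrakk>\<alpha> \<in> I; \<beta> \<in> I\<rbrakk> \<Longrightarrow> openin \<tau> {s \<in> carrier S. entry \<alpha> \<beta> s \<in> W}"
    by (auto simp: openin_extension_iff[OF fin])
  have "\<exists>V\<in>brandt_base_at z I \<B> t. t \<in> V \<and> V \<subseteq> W"
  proof (cases t)
    case Zero
    \<comment> \<open>A base set at \<open>Zero\<close> uses the same U in every block, so U has to
      fit into all the preimages at once. Their intersection is open because \<open>I\<close> is
      finite.\<close>
    have "openin \<tau> (\<Inter>(\<alpha>, \<beta>)\<in>I \<times> I. {s \<in> carrier S. entry \<alpha> \<beta> s \<in> W})" (is "openin \<tau> ?N")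
      using fin(1) I pre by (intro openin_Inter) auto
    moreover have "z \<in> ?N"
      using W Zero by auto
    ultimately obtain U where U: "U \<in> \<B> z" "U \<subseteq> ?N" "z \<in> U"
      using base[of z] unfolding base_at_def by (meson zero_closed)
    have "Zero \<in> (\<Union>\<alpha>\<in>I. \<Union>\<beta>\<in>I. entry \<alpha> \<beta> ` U)"
      using I U(3) by (force intro: image_eqI[of _ _ z])
    moreover have "(\<Union>\<alpha>\<in>I. \<Union>\<beta>\<in>I. entry \<alpha> \<beta> ` U) \<subseteq> W"
      using U(2) by auto
    ultimately show ?thesis
      using Zero U(1) by (auto simp: brandt_block_eq_image)
  next
    case (Triple \<alpha> s \<beta>)
    then have s: "\<alpha> \<in> I" "\<beta> \<in> I" "s \<in> carrier S" "s \<noteq> z" "t = entry \<alpha> \<beta> s"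
      using W by (auto simp: brandt_carrier_def brandt_elem_def)
    then obtain U where U: "U \<in> \<B> s" "s \<in> U" "U \<subseteq> {s \<in> carrier S. entry \<alpha> \<beta> s \<in> W}"
      using base[of s] pre[of \<alpha> \<beta>] W(2) unfolding base_at_def
      by (metis (mono_tags, lifting) mem_Collect_eq)
    then have "t \<in> entry \<alpha> \<beta> ` U - {Zero} \<and> entry \<alpha> \<beta> ` U - {Zero} \<subseteq> W"
      using s Triple by auto
    then show ?thesis
      using Triple U(1) by (auto simp: brandt_block_eq_image)
  qed
  then show "\<exists>V. V \<in> brandt_base S z I \<B> \<and> t \<in> V \<and> V \<subseteq> W"
    using W by (auto simp: brandt_base_def)
qed

end

section \<open>The final topology: existence and uniqueness\<close>

definition final_topology :: "('i, 's) brandt topology" where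
  "final_topology = topology (\<lambda>U. U \<subseteq> B \<and>
     (\<forall>\<alpha>\<in>I. \<forall>\<beta>\<in>I. openin \<tau> {s \<in> carrier S. entry \<alpha> \<beta> s \<in> U}))"

text \<open>Preimages commute with intersections and unions, so the defining predicate is a
  topology.\<close>

lemma openin_final_topology:
  "openin final_topology U \<longleftrightarrow>
     U \<subseteq> B \<and> (\<forall>\<alpha>\<in>I. \<forall>\<beta>\<in>I. openin \<tau> {s \<in> carrier S. entry \<alpha> \<beta> s \<in> U})"
proof -
  have "istopology (\<lambda>U. U \<subseteq> B \<and>
     (\<forall>\<alpha>\<in>I. \<forall>\<beta>\<in>I. openin \<tau> {s \<in> carrier S. entry \<alpha> \<beta> s \<in> U}))"
    unfolding istopology_def
  proof (intro conjI allI impI ballI)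
    fix U V \<alpha> \<beta>
    assume "U \<subseteq> B \<and> (\<forall>\<alpha>\<in>I. \<forall>\<beta>\<in>I. openin \<tau> {s \<in> carrier S. entry \<alpha> \<beta> s \<in> U})"
      "V \<subseteq> B \<and> (\<forall>\<alpha>\<in>I. \<forall>\<beta>\<in>I. openin \<tau> {s \<in> carrier S. entry \<alpha> \<beta> s \<in> V})"
      "\<alpha> \<in> I" "\<beta> \<in> I"
    then have "openin \<tau> ({s \<in> carrier S. entry \<alpha> \<beta> s \<in> U} \<inter> {s \<in> carrier S. entry \<alpha> \<beta> s \<in> V})"
      by blast
    then show "openin \<tau> {s \<in> carrier S. entry \<alpha> \<beta> s \<in> U \<inter> V}"
      by (rule back_subst[of "openin \<tau>"]) auto
  next
    fix \<K> \<alpha> \<beta>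
    assume "\<forall>U\<in>\<K>. U \<subseteq> B \<and> (\<forall>\<alpha>\<in>I. \<forall>\<beta>\<in>I. openin \<tau> {s \<in> carrier S. entry \<alpha> \<beta> s \<in> U})"
      "\<alpha> \<in> I" "\<beta> \<in> I"
    then have "openin \<tau> (\<Union>U\<in>\<K>. {s \<in> carrier S. entry \<alpha> \<beta> s \<in> U})"
      by blast
    then show "openin \<tau> {s \<in> carrier S. entry \<alpha> \<beta> s \<in> \<Union>\<K>}"
      by (rule back_subst[of "openin \<tau>"]) auto
  qed auto
  then show ?thesis
    by (simp add: final_topology_def)
qed

lemma topspace_final_topology [simp]: "topspace final_topology = B"
proof -
  have "{s \<in> carrier S. entry \<alpha> \<beta> s \<in> B} = topspace \<tau>" if "\<alpha> \<in> I" "\<beta> \<in> I" for \<alpha> \<beta>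
    using that by auto
  then have "openin final_topology B"
    using openin_topspace[of \<tau>] by (simp add: openin_final_topology)
  then show ?thesis
    by (metis openin_final_topology openin_subset openin_topspace subset_antisym)
qed

lemma continuous_map_elem_final:
  "\<lbrakk>\<alpha> \<in> I; \<beta> \<in> I\<rbrakk> \<Longrightarrow> continuous_map \<tau> final_topology (entry \<alpha> \<beta>)"
  by (auto simp: continuous_map openin_final_topology)

text \<open>Continuity out of a final topology is tested after composing with the entry maps; each
  composite is the identity or the constant \<open>z\<close>.\<close>

lemma continuous_map_coord_final: "continuous_map final_topology \<tau> (coord \<alpha> \<beta>)"
  unfolding continuous_map_def
proof (intro conjI allI impI funcsetI)
  fix x assume "x \<in> topspace final_topology"
  then show "coord \<alpha> \<beta> x \<in> topspace \<tau>"
    by (auto simp: brandt_coord_elem elim!: carrier_cases)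
next
  fix U assume U: "openin \<tau> U"
  have "openin \<tau> {s \<in> carrier S. entry \<gamma> \<delta> s \<in> {x \<in> B. coord \<alpha> \<beta> x \<in> U}}"
    if "\<gamma> \<in> I" "\<delta> \<in> I" for \<gamma> \<delta>
  proof -
    have "continuous_map \<tau> \<tau> (\<lambda>s. coord \<alpha> \<beta> (entry \<gamma> \<delta> s))"
      by (cases "\<alpha> = \<gamma> \<and> \<beta> = \<delta>") (simp_all add: brandt_coord_elem)
    from openin_continuous_map_preimage[OF this U] show ?thesis
      by (rule back_subst[of "openin \<tau>"]) (use that in auto)
  qed
  then show "openin final_topology {x \<in> topspace final_topology. coord \<alpha> \<beta> x \<in> U}"
    by (auto simp: openin_final_topology)
qed

text \<open>Triples in the carrier have a middle entry other than \<open>z\<close>, so distinct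
  elements differ in some coordinate.\<close>

lemma Hausdorff_final_topology: "Hausdorff_space final_topology"
proof (rule Hausdorff_space_separating_maps)
  fix x y assume "x \<in> topspace final_topology" "y \<in> topspace final_topology" "x \<noteq> y"
  then have "\<exists>\<alpha> \<beta>. coord \<alpha> \<beta> x \<noteq> coord \<alpha> \<beta> y"
    by (cases x; cases y) (auto simp: brandt_carrier_def; blast)+
  then show "\<exists>Y f. Hausdorff_space (Y :: 's topology) \<and> continuous_map final_topology Y f \<and> f x \<noteq> f y"
    using Hausdorff_tau continuous_map_coord_final by blast
qed

text \<open>For fixed indices the map is either multiplication of S followed by an entry map, or
  constantly \<open>Zero\<close>.\<close>

lemma continuous_map_mult_elem_final:
  assumes "\<alpha> \<in> I" "\<delta> \<in> I"
  shows "continuous_map (prod_topology \<tau> \<tau>) final_topology (\<lambda>(s, t). entry \<alpha> \<beta> s \<diamondop> entry \<gamma> \<delta> t)"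
proof -
  have m: "continuous_map (prod_topology \<tau> \<tau>) \<tau> (\<lambda>(s, t). s \<otimes> t)"
    using semigroup by (simp add: topological_semigroup_on_def)
  show ?thesis
  proof (cases "\<beta> = \<gamma>")
    case True
    from continuous_map_compose[OF m continuous_map_elem_final[OF assms]] show ?thesis
      by (rule continuous_map_eq) (use True in auto)
  next
    case False
    have "continuous_map (prod_topology \<tau> \<tau>) final_topology (\<lambda>_. Zero)"
      by simp
    then show ?thesis
      by (rule continuous_map_eq) (use False in auto)
  qed
qed

lemma continuous_map_mult_final:
  assumes "finite I" "compact_space \<tau>"
  shows "continuous_map (prod_topology final_topology final_topology) final_topology (\<lambda>(x, y). x \<diamondop> y)"
  unfolding continuous_map_closedin
proof (intro conjI allI impI)
  let ?P = "prod_topology final_topology final_topology" and ?Q = "prod_topology \<tau> \<tau>"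
  show "(\<lambda>(x, y). x \<diamondop> y) \<in> topspace ?P \<rightarrow> topspace final_topology"
    by (auto simp: mult_closed)
  fix C assume C: "closedin final_topology C"
  \<comment> \<open>\<open>D\<close> is the preimage of \<open>C\<close> lifted to S \<times> S
    through a pair of entry maps, and \<open>F\<close> is its image in B \<times> B. Compactness
    turns closedness of \<open>D\<close> into closedness of \<open>F\<close>.\<close>
  define D where "D \<alpha> \<beta> \<gamma> \<delta> = {q \<in> topspace ?Q. (\<lambda>(s, t). entry \<alpha> \<beta> s \<diamondop> entry \<gamma> \<delta> t) q \<in> C}"
    for \<alpha> \<beta> \<gamma> \<delta>
  define F where "F \<alpha> \<beta> \<gamma> \<delta> = (\<lambda>(s, t). (entry \<alpha> \<beta> s, entry \<gamma> \<delta> t)) ` D \<alpha> \<beta> \<gamma> \<delta>" for \<alpha> \<beta> \<gamma> \<delta>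
  have "closedin ?P (F \<alpha> \<beta> \<gamma> \<delta>)" if "\<alpha> \<in> I" "\<beta> \<in> I" "\<gamma> \<in> I" "\<delta> \<in> I" for \<alpha> \<beta> \<gamma> \<delta>
  proof -
    have "closedin ?Q (D \<alpha> \<beta> \<gamma> \<delta>)"
      unfolding D_def using that C
      by (intro closedin_continuous_map_preimage[OF continuous_map_mult_elem_final])
    moreover have "compact_space ?Q"
      using assms(2) by (simp add: compact_space_prod_topology)
    ultimately have "compactin ?Q (D \<alpha> \<beta> \<gamma> \<delta>)"
      using closedin_compact_space by blast
    moreover have "continuous_map ?Q ?P (\<lambda>(s, t). (entry \<alpha> \<beta> s, entry \<gamma> \<delta> t))"
      using that continuous_map_elem_final by (simp add: continuous_map_prod_top)
    ultimately have "compactin ?P (F \<alpha> \<beta> \<gamma> \<delta>)"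
      unfolding F_def by (rule image_compactin)
    then show ?thesis
      using Hausdorff_final_topology
      by (intro compactin_imp_closedin) (simp_all add: Hausdorff_space_prod_topology)
  qed
  then have "closedin ?P (\<Union>((\<lambda>(\<alpha>, \<beta>, \<gamma>, \<delta>). F \<alpha> \<beta> \<gamma> \<delta>) ` (I \<times> I \<times> I \<times> I)))"
    using assms(1) by (intro closedin_Union) auto
  moreover have "(\<Union>((\<lambda>(\<alpha>, \<beta>, \<gamma>, \<delta>). F \<alpha> \<beta> \<gamma> \<delta>) ` (I \<times> I \<times> I \<times> I)))
      = {q \<in> topspace ?P. (\<lambda>(x, y). x \<diamondop> y) q \<in> C}" (is "?L = ?R")
  proof
    show "?L \<subseteq> ?R"
      \<comment> \<open>Products of entries are left unevaluated so that they match the form in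
        which \<open>D\<close> speaks of \<open>C\<close>.\<close>
      by (auto simp del: mult_elem simp: F_def D_def)
    show "?R \<subseteq> ?L"
    proof clarsimp
      fix x y assume xy: "x \<in> B" "y \<in> B" "x \<diamondop> y \<in> C"
      from xy(1) obtain \<alpha> \<beta> s where x: "\<alpha> \<in> I" "\<beta> \<in> I" "s \<in> carrier S" "x = entry \<alpha> \<beta> s"
        by (rule carrier_cases)
      from xy(2) obtain \<gamma> \<delta> t where y: "\<gamma> \<in> I" "\<delta> \<in> I" "t \<in> carrier S" "y = entry \<gamma> \<delta> t"
        by (rule carrier_cases)
      have "(s, t) \<in> D \<alpha> \<beta> \<gamma> \<delta>"
        using xy x y by (simp add: D_def del: mult_elem)
      then have "(x, y) \<in> F \<alpha> \<beta> \<gamma> \<delta>"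
        using x y by (force simp: F_def)
      then show "\<exists>\<alpha>\<in>I. \<exists>\<beta>\<in>I. \<exists>\<gamma>\<in>I. \<exists>\<delta>\<in>I. (x, y) \<in> F \<alpha> \<beta> \<gamma> \<delta>"
        using x y by blast
    qed
  qed
  ultimately show "closedin ?P {q \<in> topspace ?P. (\<lambda>(x, y). x \<diamondop> y) q \<in> C}"
    by simp
qed

text \<open>Each diagonal block carries the topology of S, since
  \<open>coord \<alpha> \<alpha>\<close> is a continuous inverse of the entry map on it.\<close>

lemma extension_final_topology:
  assumes "finite I" "compact_space \<tau>"
  shows "extension final_topology"
  unfolding topological_brandt_extension_def
proof
  show "topological_semigroup_on B (\<diamondop>) final_topology"
    unfolding topological_semigroup_on_def
    using Hausdorff_final_topology continuous_map_mult_final[OF assms]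
    by (simp add: mult_closed mult_assoc)
  obtain \<alpha> where \<alpha>: "\<alpha> \<in> I" using I by blast
  have "homeomorphic_maps \<tau> (subtopology final_topology (entry \<alpha> \<alpha> ` carrier S)) (entry \<alpha> \<alpha>) (coord \<alpha> \<alpha>)"
    unfolding homeomorphic_maps_def
    using \<alpha> by (auto simp: brandt_coord_elem continuous_map_in_subtopology
        continuous_map_elem_final continuous_map_coord_final continuous_map_from_subtopology)
  then show "\<exists>\<alpha>\<in>I. homeomorphic_map \<tau>
      (subtopology final_topology (brandt_block z (carrier S) \<alpha> \<alpha>)) (brandt_embed z \<alpha>)"
    using \<alpha> homeomorphic_map_maps brandt_embed_eq_elem brandt_block_eq_image by metis
qed

text \<open>For finite \<open>I\<close> and compact S the open sets of any extension obey the very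
  condition that defines the final topology.\<close>

lemma extension_unique:
  assumes "finite I" "compact_space \<tau>" "extension Y"
  shows "Y = final_topology"
  by (simp add: topology_eq openin_extension_iff[OF assms(3,1,2)] openin_final_topology)

end

theorem proposition5p8:
  fixes S :: "('s, 'm) monoid_scheme" and z :: 's and \<tau> :: "'s topology" and I :: "'i set"
  assumes "topological_monoid_with_zero S z \<tau>" and "I \<noteq> {}"
  shows "(carrier S \<noteq> {z} \<longrightarrow>
            (\<forall>\<tau>\<^sub>B. topological_brandt_extension S z \<tau> I \<tau>\<^sub>B \<longrightarrow>
               (compact_space \<tau>\<^sub>B \<longleftrightarrow> finite I \<and> compact_space \<tau>))) \<and>
         (compact_space \<tau> \<and> finite I \<longrightarrow>
            (\<exists>!\<tau>\<^sub>B. topological_brandt_extension S z \<tau> I \<tau>\<^sub>B \<and> compact_space \<tau>\<^sub>B) \<and>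
            (\<forall>\<tau>\<^sub>B \<B>. topological_brandt_extension S z \<tau> I \<tau>\<^sub>B \<and> compact_space \<tau>\<^sub>B \<and>
               (\<forall>s\<in>carrier S. base_at \<tau> s (\<B> s)) \<longrightarrow>
               openin \<tau>\<^sub>B = arbitrary union_of (\<lambda>W. W \<in> brandt_base S z I \<B>)))"
proof -
  interpret brandt_setting S z \<tau> I
    using assms by unfold_locales
  show ?thesis
  proof (intro conjI impI allI)
    fix Y assume "carrier S \<noteq> {z}" "extension Y"
    then show "compact_space Y \<longleftrightarrow> finite I \<and> compact_space \<tau>"
      using compact_extension compact_of_compact_extension finite_index_of_compact_extension
      by blast
  next
    assume "compact_space \<tau> \<and> finite I"
    \<comment> \<open>The final topology is the witness; it is compact because every extension is
      under these hypotheses.\<close>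
    then show "\<exists>!\<tau>\<^sub>B. extension \<tau>\<^sub>B \<and> compact_space \<tau>\<^sub>B"
      using extension_final_topology extension_unique compact_extension by blast
  next
    fix Y \<B>
    assume "compact_space \<tau> \<and> finite I"
      "extension Y \<and> compact_space Y \<and> (\<forall>s\<in>carrier S. base_at \<tau> s (\<B> s))"
    then show "openin Y = arbitrary union_of (\<lambda>W. W \<in> brandt_base S z I \<B>)"
      by (intro openin_extension_base) auto
  qed
qed

end
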